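(* Let $\mathcal{A}$ be a regular Baer *-ring ordered by $\preceq^{\alpha}$, where $\alpha\in\{\ell*,\ \ell*|\ell\square,\ \ell*|r\square,\ \ell*|\square\}$. If $b\in\mathcal{A}$ is an upper bound (with respect to $\preceq^{\alpha}$) of a nonempty subset $B\subseteq\mathcal{A}$, then: (a) $\left(\bigvee\{\mathrm{lp}(c): c\in B\}\right)b$ is the least upper bound of $B$ in $[0,b]^{\alpha}$; (b) $\left(\bigwedge\{\mathrm{lp}(c): c\in B\}\right)b$ is the greatest lower bound of $B$ in $[0,b]^{\alpha}$. Here $[0,b]^{\alpha}=\{a\in\mathcal{A}: a\preceq^{\alpha}b\}$ is ordered by $\preceq^{\alpha}$, and $\bigvee$, $\bigwedge$ of sets of self-adjoint idempotents are taken in the complete lattice $E(\mathcal{A})$.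
   Context: A *-ring is an (associative) ring $\mathcal{A}$ with an involution $*$: $(a+b)^*=a^*+b^*$, $(ab)^*=b^*a^*$, $(a^* )^*=a$. A Baer *-ring is a *-ring in which the right annihilator of every subset is a principal right ideal generated by a self-adjoint idempotent ($p=p^*=p^2$). Let $E(\mathcal{A})$ be the set of self-adjoint idempotents, partially ordered by $p\le q$ iff $p=pq$. A Baer *-ring has an identity $1$ and is a Rickart *-ring: for every $a$ there are unique self-adjoint idempotents $\mathrm{lp}(a)$, $\mathrm{rp}(a)$ with $\{x: xa=0\}=\mathcal{A}(1-\mathrm{lp}(a))$ and $\{x: ax=0\}=(1-\mathrm{rp}(a))\mathcal{A}$; moreover it is known that $E(\mathcal{A})$ is a complete lattice. The ring is regular if for every $a\in\mathcal{A}$ there is $a^-\in\mathcal{A}$ with $aa^-a=a$. Partial orders on $\mathcal{A}$: $a\preceq^{\ell*} b$ iff $\mathrm{lp}(a)b=a=\mathrm{lp}(b)a$ (left star order); $a\preceq^{\ell*|\ell\square} b$ iff $a\preceq^{\ell*}b$ and $a^2=ab$; $a\preceq^{\ell*|r\square} b$ iff $a\preceq^{\ell*}b$ and $a^2=ba$; $a\preceq^{\ell*|\square} b$ iff $a\preceq^{\ell*}b$ and $a^2=ab=ba$. *)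

theory Defs
  imports "HOL-Algebra.Complete_Lattice"
begin

class star_ring = ring +
  fixes star :: "'a \<Rightarrow> 'a"  ("_\<^sup>\<star>" [1000] 1000)
  assumes star_add: "(a + b)\<^sup>\<star> = a\<^sup>\<star> + b\<^sup>\<star>"
    and star_mult: "(a * b)\<^sup>\<star> = b\<^sup>\<star> * a\<^sup>\<star>"
    and star_star: "(a\<^sup>\<star>)\<^sup>\<star> = a"

definition projections :: "'a::star_ring set"
  where "projections = {p. p = p\<^sup>\<star> \<and> p = p * p}"

text \<open>Class \<^class>\<open>ring\<close> does not require an identity. A self-adjoint idempotent generates
  the principal right ideal of its right multiples.\<close>

class baer_star_ring = star_ring +
  assumes baer: "\<exists>p. p = p\<^sup>\<star> \<and> p = p * p \<and> {x. \<forall>s\<in>S. s * x = 0} = {p * x | x. True}"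

class regular_baer_star_ring = baer_star_ring +
  assumes regular: "\<exists>x. a * x * a = a"

text \<open>The identity of a Baer *-ring; its existence is a consequence of the annihilator
  condition (lemma \<open>ident\<close>).\<close>

definition ident :: "'a::star_ring"
  where "ident = (THE u. \<forall>x. u * x = x \<and> x * u = x)"

text \<open>Left projection; existence and uniqueness are shown in lemma \<open>ex1_lp\<close>.\<close>

definition lp :: "'a::star_ring \<Rightarrow> 'a"
  where "lp a = (THE p. p \<in> projections \<and> {x. x * a = 0} = {y * (ident - p) | y. True})"

definition proj_order :: "'a::star_ring gorder"
  where "proj_order = \<lparr>carrier = projections, eq = (=), le = (\<lambda>p q. p = p * q)\<rparr>"

definition left_star_le :: "'a::star_ring \<Rightarrow> 'a \<Rightarrow> bool"
  where "left_star_le a b \<longleftrightarrow> lp a * b = a \<and> a = lp b * a"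

datatype star_order = LStar | LStar_LSquare | LStar_RSquare | LStar_Square

fun order_le :: "star_order \<Rightarrow> 'a::star_ring \<Rightarrow> 'a \<Rightarrow> bool"
  where
    "order_le LStar a b \<longleftrightarrow> left_star_le a b"
  | "order_le LStar_LSquare a b \<longleftrightarrow> left_star_le a b \<and> a * a = a * b"
  | "order_le LStar_RSquare a b \<longleftrightarrow> left_star_le a b \<and> a * a = b * a"
  | "order_le LStar_Square a b \<longleftrightarrow> left_star_le a b \<and> a * a = a * b \<and> a * b = b * a"

definition initial_segment :: "star_order \<Rightarrow> 'a::star_ring \<Rightarrow> 'a gorder"
  where "initial_segment \<alpha> b = \<lparr>carrier = {a. order_le \<alpha> a b}, eq = (=), le = order_le \<alpha>\<rparr>"

lemma star_zero: "(0::'a::star_ring)\<^sup>\<star> = 0"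
  using star_add[of "0::'a" 0] by simp

lemma star_diff: "((a::'a::star_ring) - b)\<^sup>\<star> = a\<^sup>\<star> - b\<^sup>\<star>"
  using star_add[of "a - b" b] by (simp add: algebra_simps)

lemma ident: "ident * (x::'a::baer_star_ring) = x" "x * ident = x"
proof -
  obtain p :: 'a where p: "p = p\<^sup>\<star>" "p = p * p" "{x. \<forall>s\<in>{}. s * x = 0} = {p * x | x. True}"
    using baer[of "{}"] by blast
  have left: "p * y = y" for y
  proof -
    have "y \<in> {p * x | x. True}" using p(3) by auto
    then obtain z where "y = p * z" by blast
    then show ?thesis by (metis p(2) mult.assoc)
  qed
  have right: "y * p = y" for y
    using left[of "y\<^sup>\<star>"] p(1) by (metis star_mult star_star)
  have "ident = p" unfolding ident_def
    by (rule the_equality) (use left right in metis)+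
  then show "ident * x = x" "x * ident = x" using left right by auto
qed

lemma star_ident: "(ident::'a::baer_star_ring)\<^sup>\<star> = ident"
  by (metis ident star_mult star_star)

lemma ident_diff_projection:
  fixes p :: "'a::baer_star_ring"
  assumes "p \<in> projections"
  shows "ident - p \<in> projections"
  using assms by (simp add: projections_def star_diff star_ident algebra_simps ident)

lemma right_annihilator_projection:
  fixes S :: "'a::baer_star_ring set"
  obtains e where "e \<in> projections" "\<And>x. (\<forall>s\<in>S. s * x = 0) \<longleftrightarrow> e * x = x"
proof -
  obtain e where e: "e = e\<^sup>\<star>" "e = e * e" "{x. \<forall>s\<in>S. s * x = 0} = {e * x | x. True}"
    using baer[of S] by blast
  have "(\<forall>s\<in>S. s * x = 0) \<longleftrightarrow> e * x = x" for x
  proof -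
    have "(\<forall>s\<in>S. s * x = 0) \<longleftrightarrow> (\<exists>y. x = e * y)" using e(3) by blast
    also have "\<dots> \<longleftrightarrow> e * x = x" by (metis e(2) mult.assoc)
    finally show ?thesis .
  qed
  with e show ?thesis by (intro that[of e]) (auto simp: projections_def)
qed

lemma projection_le_iff:
  assumes "p \<in> projections" "q \<in> projections"
  shows "(p::'a::star_ring) = p * q \<longleftrightarrow> p = q * p"
  using assms by (metis (mono_tags, lifting) mem_Collect_eq projections_def star_mult)

lemma projection_right_multiples:
  assumes "q \<in> projections"
  shows "x \<in> {y * q | y. True} \<longleftrightarrow> (x::'a::star_ring) * q = x"
  using assms unfolding projections_def by simp (metis mult.assoc)

lemma ex1_lp:
  "\<exists>!p. p \<in> projections \<and> {x. x * (a::'a::baer_star_ring) = 0} = {y * (ident - p) | y. True}"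
proof (rule ex_ex1I)
  obtain e where e: "e \<in> projections" "\<And>x. (\<forall>s\<in>{a\<^sup>\<star>}. s * x = 0) \<longleftrightarrow> e * x = x"
    using right_annihilator_projection by blast
  have "x * a = 0 \<longleftrightarrow> x * e = x" for x
    using e(2)[of "x\<^sup>\<star>"] e(1) unfolding projections_def
    by (metis (mono_tags, lifting) mem_Collect_eq singletonD singletonI star_mult star_star star_zero)
  then have "{x. x * a = 0} = {y * (ident - (ident - e)) | y. True}"
    using projection_right_multiples[OF e(1)] by auto
  then show "\<exists>p. p \<in> projections \<and> {x. x * a = 0} = {y * (ident - p) | y. True}"
    using ident_diff_projection[OF e(1)] by blast
next
  fix p q
  assume p: "p \<in> projections \<and> {x. x * a = 0} = {y * (ident - p) | y. True}"
    and q: "q \<in> projections \<and> {x. x * a = 0} = {y * (ident - q) | y. True}"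
  have eq: "x * (ident - p) = x \<longleftrightarrow> x * (ident - q) = x" for x
    using p q projection_right_multiples ident_diff_projection by blast
  let ?p = "ident - p" and ?q = "ident - q"
  have P: "?p \<in> projections" "?q \<in> projections" using p q ident_diff_projection by auto
  then have "?p * ?p = ?p" "?q * ?q = ?q" by (auto simp: projections_def)
  then have "?p * ?q = ?p" "?q * ?p = ?q" using eq by blast+
  then have "?p = ?q" using projection_le_iff P by metis
  then show "p = q" by simp
qed

lemma proj_order_complete_lattice:
  "complete_lattice (proj_order :: 'a::baer_star_ring gorder)"
proof -
  let ?L = "proj_order :: 'a gorder"
  have po: "partial_order ?L"
  proof (unfold_locales)
    fix x y z :: 'a
    assume "x \<in> carrier ?L" "y \<in> carrier ?L" "z \<in> carrier ?L" "le ?L x y" "le ?L y z"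
    then show "le ?L x z" by (simp add: proj_order_def) (metis mult.assoc)
  next
    fix x y :: 'a
    assume "le ?L x y" "le ?L y x" "x \<in> carrier ?L" "y \<in> carrier ?L"
    then show "eq ?L x y" by (simp add: proj_order_def) (metis projection_le_iff)
  qed (auto simp: proj_order_def projections_def)
  show ?thesis
  proof (intro complete_lattice.intro complete_lattice_axioms.intro po)
    fix S assume S: "S \<subseteq> carrier ?L"
    obtain e where e: "e \<in> projections" "\<And>x. (\<forall>s\<in>S. s * x = 0) \<longleftrightarrow> e * x = x"
      using right_annihilator_projection by blast
    have P: "ident - e \<in> projections" using e(1) by (rule ident_diff_projection)
    have ub: "(\<forall>s\<in>S. s = s * t) \<longleftrightarrow> ident - e = (ident - e) * t" for t
      using e(2)[of "ident - t"] by (auto simp: algebra_simps ident)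
    then have "is_lub ?L (ident - e) S"
      using S P unfolding least_def Upper_def proj_order_def
      by (auto simp: projections_def)
    then show "\<exists>s. is_lub ?L s S" ..
  next
    fix S assume S: "S \<subseteq> carrier ?L"
    obtain e where e: "e \<in> projections"
        "\<And>x. (\<forall>s\<in>(\<lambda>s. ident - s) ` S. s * x = 0) \<longleftrightarrow> e * x = x"
      using right_annihilator_projection by blast
    have lb: "(\<forall>s\<in>S. t = t * s) \<longleftrightarrow> t = t * e" if t: "t \<in> projections" for t
    proof -
      have "(\<forall>s\<in>S. t = t * s) \<longleftrightarrow> (\<forall>s\<in>S. t = s * t)"
        using S t projection_le_iff by (auto simp: proj_order_def)
      also have "\<dots> \<longleftrightarrow> e * t = t"
        using e(2)[of t] by (auto simp: algebra_simps ident)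
      also have "\<dots> \<longleftrightarrow> t = t * e" using projection_le_iff[OF t e(1)] by metis
      finally show ?thesis .
    qed
    have "is_glb ?L e S"
      using S e(1) lb lb[OF e(1)] unfolding greatest_def Lower_def proj_order_def
      by (auto simp: projections_def)
    then show "\<exists>i. is_glb ?L i S" ..
  qed
qed

end

(*
  Put e = lp b.  Since lp (p * b) = p for every projection p \<le> e, the map c |-> lp c is an order
  isomorphism from the initial segment of b onto the set of those projections p \<le> e that satisfy
  p * b * p = p * b * e and/or p * b * p = b * p, depending on the order.  These conditions say
  that the range of p is invariant under the adjoint of b * e, respectively under b.  Invariance
  passes to arbitrary suprema and infima of projections, so these can be computed in the complete
  lattice of all projections.
*)
theory Submission
  imports Defs
begin

lemma projection_idem: "p \<in> projections \<Longrightarrow> p * p = p"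
  and projection_star: "p \<in> projections \<Longrightarrow> p\<^sup>\<star> = p"
  by (auto simp: projections_def)

lemma projection_absorb_commute:
  assumes "p \<in> projections" "q \<in> projections"
  shows "(p::'a::star_ring) * q = p \<longleftrightarrow> q * p = p"
  using projection_le_iff[OF assms] by metis

lemma lp_projection: "lp (a::'a::baer_star_ring) \<in> projections"
  and lp_annihilator: "{x. x * a = 0} = {y * (ident - lp a) | y. True}"
  using theI'[OF ex1_lp[of a]] unfolding lp_def[symmetric] by (rule conjunct1, rule conjunct2)

text \<open>Lying in the left ideal generated by the projection \<open>ident - lp a\<close> means
  being fixed by right multiplication with it, that is, being annihilated by \<open>lp a\<close>. In
  equations a right factor \<open>a\<close> may therefore be exchanged for
  \<open>lp a\<close>.\<close>

lemma mult_lp_eq_0_iff: "x * lp (a::'a::baer_star_ring) = 0 \<longleftrightarrow> x * a = 0"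
proof -
  have "x * a = 0 \<longleftrightarrow> x \<in> {x. x * a = 0}" by (rule mem_Collect_eq[symmetric])
  also have "\<dots> \<longleftrightarrow> x \<in> {y * (ident - lp a) | y. True}" by (simp only: lp_annihilator)
  also have "\<dots> \<longleftrightarrow> x * (ident - lp a) = x"
    by (rule projection_right_multiples[OF ident_diff_projection[OF lp_projection]])
  finally show ?thesis by (simp add: algebra_simps ident)
qed

lemma mult_lp_eq_iff: "x * lp (a::'a::baer_star_ring) = y * lp a \<longleftrightarrow> x * a = y * a"
  using mult_lp_eq_0_iff[of "x - y" a] by (simp add: algebra_simps)

text \<open>The second assumption says that \<open>ident - p\<close> generates the left annihilator
  of \<open>a\<close>, and by \<open>ex1_lp\<close> only one projection has this property.\<close>

lemma lp_eqI:
  fixes a :: "'a::baer_star_ring"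
  assumes "p \<in> projections" and "\<And>x. x * a = 0 \<longleftrightarrow> x * p = 0"
  shows "lp a = p"
proof -
  have "{x. x * a = 0} = {y * (ident - p) | y. True}"
  proof (rule Set.set_eqI)
    fix x
    have "x * a = 0 \<longleftrightarrow> x * (ident - p) = x"
      using assms(2)[of x] by (simp add: algebra_simps ident)
    then show "x \<in> {x. x * a = 0} \<longleftrightarrow> x \<in> {y * (ident - p) | y. True}"
      by (simp only: mem_Collect_eq[of x "\<lambda>x. x * a = 0"]
          projection_right_multiples[OF ident_diff_projection[OF assms(1)]])
  qed
  with assms(1) show ?thesis
    unfolding lp_def by (intro the1_equality[OF ex1_lp] conjI)
qed

lemma lp_mult_self: "lp a * a = (a::'a::baer_star_ring)"
  using mult_lp_eq_iff[of "lp a" a ident] by (simp add: ident projection_idem lp_projection)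

text \<open>\<open>x * p * b\<close> vanishes exactly when \<open>x * p * lp b\<close> does, and the
  latter is \<open>x * p\<close>. Through this a supremum or infimum of projections below
  \<open>lp b\<close> is carried back to an element of the ring.\<close>

lemma lp_projection_mult:
  fixes b :: "'a::baer_star_ring"
  assumes "p \<in> projections" "p * lp b = p"
  shows "lp (p * b) = p"
proof (rule lp_eqI[OF assms(1)])
  fix x
  have "x * (p * b) = 0 \<longleftrightarrow> x * p * lp b = 0"
    by (simp only: mult_lp_eq_0_iff mult.assoc[symmetric])
  then show "x * (p * b) = 0 \<longleftrightarrow> x * p = 0" using assms(2) by (metis mult.assoc)
qed

lemma
  fixes P :: "'a::baer_star_ring set"
  assumes "P \<subseteq> projections"
  shows proj_Sup_projection: "\<Squnion>\<^bsub>proj_order\<^esub>P \<in> projections"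
    and proj_Sup_upper: "p \<in> P \<Longrightarrow> p * \<Squnion>\<^bsub>proj_order\<^esub>P = p"
    and proj_Sup_least: "r \<in> projections \<Longrightarrow> (\<And>p. p \<in> P \<Longrightarrow> p * r = p) \<Longrightarrow>
      \<Squnion>\<^bsub>proj_order\<^esub>P * r = \<Squnion>\<^bsub>proj_order\<^esub>P"
    and proj_Inf_projection: "\<Sqinter>\<^bsub>proj_order\<^esub>P \<in> projections"
    and proj_Inf_lower: "p \<in> P \<Longrightarrow> \<Sqinter>\<^bsub>proj_order\<^esub>P * p = \<Sqinter>\<^bsub>proj_order\<^esub>P"
    and proj_Inf_greatest: "r \<in> projections \<Longrightarrow> (\<And>p. p \<in> P \<Longrightarrow> r * p = r) \<Longrightarrow>
      r * \<Sqinter>\<^bsub>proj_order\<^esub>P = r"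
proof -
  let ?L = "proj_order :: 'a gorder"
  interpret complete_lattice ?L by (rule proj_order_complete_lattice)
  have [simp]: "carrier ?L = projections" "\<And>p q. le ?L p q \<longleftrightarrow> p * q = p"
    by (auto simp: proj_order_def)
  have sub: "P \<subseteq> carrier ?L" using assms by simp
  show "\<Squnion>\<^bsub>?L\<^esub>P \<in> projections" using sup_closed[OF sub] by simp
  show "p \<in> P \<Longrightarrow> p * \<Squnion>\<^bsub>?L\<^esub>P = p" using sup_upper[OF sub, of p] by simp
  show "r \<in> projections \<Longrightarrow> (\<And>p. p \<in> P \<Longrightarrow> p * r = p) \<Longrightarrow> \<Squnion>\<^bsub>?L\<^esub>P * r = \<Squnion>\<^bsub>?L\<^esub>P"
    using sup_least[OF sub, of r] by simp
  show "\<Sqinter>\<^bsub>?L\<^esub>P \<in> projections" using inf_closed[OF sub] by simp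
  show "p \<in> P \<Longrightarrow> \<Sqinter>\<^bsub>?L\<^esub>P * p = \<Sqinter>\<^bsub>?L\<^esub>P" using inf_lower[OF sub, of p] by simp
  show "r \<in> projections \<Longrightarrow> (\<And>p. p \<in> P \<Longrightarrow> r * p = r) \<Longrightarrow> r * \<Sqinter>\<^bsub>?L\<^esub>P = r"
    using inf_greatest[OF sub, of r] by simp
qed

text \<open>The right annihilator of \<open>x\<close> is generated by a projection \<open>e\<close>.
  It contains \<open>P\<close>, so \<open>e\<close> is an upper bound of \<open>P\<close> and lies
  above the supremum.\<close>

lemma mult_proj_Sup_eq_0:
  fixes P :: "'a::baer_star_ring set"
  assumes P: "P \<subseteq> projections" and x: "\<And>p. p \<in> P \<Longrightarrow> x * p = 0"
  shows "x * \<Squnion>\<^bsub>proj_order\<^esub>P = 0"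
proof -
  obtain e where e: "e \<in> projections" "\<And>y. (\<forall>s\<in>{x}. s * y = 0) \<longleftrightarrow> e * y = y"
    using right_annihilator_projection by blast
  have "p * e = p" if "p \<in> P" for p
    using e x[OF that] P that projection_absorb_commute by (metis singletonD subsetD)
  then have "e * \<Squnion>\<^bsub>proj_order\<^esub>P = \<Squnion>\<^bsub>proj_order\<^esub>P"
    using proj_Sup_least[OF P e(1)] projection_absorb_commute[OF proj_Sup_projection[OF P] e(1)] by blast
  then show ?thesis using e(2)[of "\<Squnion>\<^bsub>proj_order\<^esub>P"] by simp
qed

lemma proj_Sup_mult_eq_0:
  fixes P :: "'a::baer_star_ring set"
  assumes P: "P \<subseteq> projections" and x: "\<And>p. p \<in> P \<Longrightarrow> p * x = 0"
  shows "\<Squnion>\<^bsub>proj_order\<^esub>P * x = 0"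
proof -
  have "x\<^sup>\<star> * p = 0" if "p \<in> P" for p
    using x[OF that] P that projection_star by (metis star_mult star_zero subsetD)
  then have "x\<^sup>\<star> * \<Squnion>\<^bsub>proj_order\<^esub>P = 0" by (rule mult_proj_Sup_eq_0[OF P])
  then show ?thesis
    by (metis projection_star[OF proj_Sup_projection[OF P]] star_mult star_star star_zero)
qed

text \<open>A projection fixes \<open>x\<close> from the left exactly when it lies above
  \<open>lp x\<close>. Thus \<open>lp x\<close> is a lower bound of \<open>P\<close> and lies below
  the infimum.\<close>

lemma proj_Inf_mult_eq:
  fixes P :: "'a::baer_star_ring set"
  assumes P: "P \<subseteq> projections" and x: "\<And>p. p \<in> P \<Longrightarrow> p * x = x"
  shows "\<Sqinter>\<^bsub>proj_order\<^esub>P * x = x"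
proof -
  have "lp x * p = lp x" if "p \<in> P" for p
  proof -
    have "p * lp x = ident * lp x" unfolding mult_lp_eq_iff using x[OF that] by (simp add: ident)
    then show ?thesis
      using projection_absorb_commute[OF lp_projection] P that by (metis ident(1) subsetD)
  qed
  then have "\<Sqinter>\<^bsub>proj_order\<^esub>P * lp x = lp x"
    using proj_Inf_greatest[OF P lp_projection]
      projection_absorb_commute[OF lp_projection proj_Inf_projection[OF P]] by blast
  then show ?thesis by (metis lp_mult_self mult.assoc)
qed

lemma mult_proj_Inf_eq:
  fixes P :: "'a::baer_star_ring set"
  assumes P: "P \<subseteq> projections" and x: "\<And>p. p \<in> P \<Longrightarrow> x * p = x"
  shows "x * \<Sqinter>\<^bsub>proj_order\<^esub>P = x"
proof -
  have "p * x\<^sup>\<star> = x\<^sup>\<star>" if "p \<in> P" for p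
    using x[OF that] P that projection_star by (metis star_mult subsetD)
  then have "\<Sqinter>\<^bsub>proj_order\<^esub>P * x\<^sup>\<star> = x\<^sup>\<star>" by (rule proj_Inf_mult_eq[OF P])
  then show ?thesis
    by (metis projection_star[OF proj_Inf_projection[OF P]] star_mult star_star)
qed

text \<open>The argument \<open>p\<close> stands for \<open>lp c\<close>, where
  \<open>c = p * b\<close>. The two equations are \<open>c * c = c * b\<close> and
  \<open>c * c = b * c\<close> after cancelling \<open>b\<close> on the right. In the first one this
  cancellation leaves the factor \<open>lp b\<close>.\<close>

fun compatible :: "star_order \<Rightarrow> 'a::star_ring \<Rightarrow> 'a \<Rightarrow> bool"
  where
    "compatible LStar b p \<longleftrightarrow> True"
  | "compatible LStar_LSquare b p \<longleftrightarrow> p * b * p = p * b * lp b"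
  | "compatible LStar_RSquare b p \<longleftrightarrow> p * b * p = b * p"
  | "compatible LStar_Square b p \<longleftrightarrow> p * b * p = p * b * lp b \<and> p * b * p = b * p"

lemma order_le_iff:
  fixes b :: "'a::baer_star_ring"
  shows "order_le \<alpha> c b \<longleftrightarrow> lp c * b = c \<and> lp c * lp b = lp c \<and> compatible \<alpha> b (lp c)"
proof -
  have le: "left_star_le c b \<longleftrightarrow> lp c * b = c \<and> lp c * lp b = lp c"
    using mult_lp_eq_iff[of "lp b" c ident] projection_absorb_commute[OF lp_projection lp_projection, of c b]
    unfolding left_star_le_def by (auto simp: ident)
  have sq: "c * c = c * b \<longleftrightarrow> lp c * b * lp c = lp c * b * lp b"
    "c * c = b * c \<longleftrightarrow> lp c * b * lp c = b * lp c" if "left_star_le c b"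
  proof -
    from that le have c: "lp c * b = c" and e: "lp c * lp b = lp c" by auto
    \<comment> \<open>The second factor \<open>c\<close> is written as \<open>lp c * b\<close>, so
      that both sides end in \<open>b\<close>, which is then exchanged for
      \<open>lp b\<close>.\<close>
    have "c * c = c * b \<longleftrightarrow> c * lp c * b = c * b" using c by (simp add: mult.assoc)
    also have "\<dots> \<longleftrightarrow> c * lp c * lp b = c * lp b" by (rule mult_lp_eq_iff[symmetric])
    finally show "c * c = c * b \<longleftrightarrow> lp c * b * lp c = lp c * b * lp b"
      using c e by (simp add: mult.assoc)
    show "c * c = b * c \<longleftrightarrow> lp c * b * lp c = b * lp c"
      using c mult_lp_eq_iff[of c c b] by simp
  qed
  show ?thesis by (cases \<alpha>) (use le sq in auto)
qed

lemma order_le_projection_mult: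
  fixes b :: "'a::baer_star_ring"
  assumes "p \<in> projections" "p * lp b = p" "compatible \<alpha> b p"
  shows "order_le \<alpha> (p * b) b"
  using assms lp_projection_mult[OF assms(1,2)] by (simp add: order_le_iff)

text \<open>Inside the initial segment only the projections matter: since
  \<open>d = lp d * b\<close> and \<open>lp c\<close> lies below \<open>lp d\<close>, compatibility
  of \<open>lp c\<close> with \<open>b\<close> is inherited by \<open>d\<close>.\<close>

lemma order_le_below_iff:
  fixes b :: "'a::baer_star_ring"
  assumes c: "order_le \<alpha> c b" and d: "order_le \<alpha> d b"
  shows "order_le \<alpha> c d \<longleftrightarrow> lp c * lp d = lp c"
proof
  show "order_le \<alpha> c d \<Longrightarrow> lp c * lp d = lp c" by (simp add: order_le_iff)
next
  assume le: "lp c * lp d = lp c"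
  have cb: "lp c * b = c" and db: "lp d * b = d" using c d by (auto simp: order_le_iff)
  have cd: "lp c * d = c" using le cb db by (metis mult.assoc)
  have left: "lp c * d * lp c = lp c * d * lp d" if "lp c * b * lp c = lp c * b * lp b"
  proof -
    have "c * lp c = c * lp c * lp d" using le by (simp add: mult.assoc)
    \<comment> \<open>As \<open>lp c * b = c\<close>, the assumption reads
      \<open>c * lp c = c * lp b\<close>.\<close>
    also have "\<dots> = c * (lp b * lp d)" using that cb by (simp add: mult.assoc)
    also have "lp b * lp d = lp d"
      using d projection_absorb_commute[OF lp_projection lp_projection, of d b] by (simp add: order_le_iff)
    finally show ?thesis using cd by simp
  qed
  have right: "lp c * d * lp c = d * lp c" if "lp c * b * lp c = b * lp c"
  proof -
    have dc: "lp d * lp c = lp c"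
      using le projection_absorb_commute[OF lp_projection lp_projection, of c d] by simp
    have "d * lp c = lp d * (b * lp c)" using db by (simp add: mult.assoc[symmetric])
    also have "\<dots> = lp d * lp c * (b * lp c)" using that by (simp add: mult.assoc)
    also have "\<dots> = b * lp c" using dc that by (simp add: mult.assoc)
    finally show ?thesis using that cb cd by simp
  qed
  have "compatible \<alpha> b (lp c)" using c by (simp add: order_le_iff)
  then have "compatible \<alpha> d (lp c)" by (cases \<alpha>) (use left right in auto)
  then show "order_le \<alpha> c d" using cd le by (simp add: order_le_iff)
qed

lemma compatible_proj_Sup:
  fixes b :: "'a::baer_star_ring"
  assumes P: "P \<subseteq> projections" and le: "\<And>p. p \<in> P \<Longrightarrow> p * lp b = p"
    and comp: "\<And>p. p \<in> P \<Longrightarrow> compatible \<alpha> b p"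
  shows "compatible \<alpha> b (\<Squnion>\<^bsub>proj_order\<^esub>P)"
proof -
  define q where "q = \<Squnion>\<^bsub>proj_order\<^esub>P"
  have q: "q \<in> projections" and up: "\<And>p. p \<in> P \<Longrightarrow> p * q = p" and qb: "lp b * q = q"
    using proj_Sup_projection[OF P] proj_Sup_upper[OF P]
      proj_Sup_least[OF P lp_projection le]
      projection_absorb_commute[OF proj_Sup_projection[OF P] lp_projection, of b]
    by (auto simp: q_def)
  have up': "q * p = p" if "p \<in> P" for p
    using up[OF that] projection_absorb_commute[OF _ q, of p] P that by auto
  have left: "q * b * q = q * b * lp b" if hyp: "\<And>p. p \<in> P \<Longrightarrow> p * b * p = p * b * lp b"
  proof -
    \<comment> \<open>The right factor does not depend on \<open>p\<close>, so its annihilation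
      passes from the members of \<open>P\<close> to their supremum \<open>q\<close>.\<close>
    have "p * (b * q - b * lp b) = 0" if p: "p \<in> P" for p
    proof -
      \<comment> \<open>Inserting \<open>lp b\<close> in front of \<open>q\<close> lets the
        hypothesis on \<open>p\<close> apply.\<close>
      have "p * b * q = p * b * lp b * q" using qb by (simp add: mult.assoc)
      also have "\<dots> = p * b * p * q" using hyp[OF p] by simp
      also have "\<dots> = p * b * p" using up[OF p] by (simp add: mult.assoc)
      also have "\<dots> = p * b * lp b" by (rule hyp[OF p])
      finally show ?thesis by (simp add: algebra_simps)
    qed
    then have "q * (b * q - b * lp b) = 0"
      unfolding q_def by (rule proj_Sup_mult_eq_0[OF P])
    then show ?thesis by (simp add: algebra_simps)
  qed
  have right: "q * b * q = b * q" if hyp: "\<And>p. p \<in> P \<Longrightarrow> p * b * p = b * p"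
  proof -
    \<comment> \<open>\<open>b * p = p * b * p\<close> begins with \<open>p\<close> and is therefore
      fixed by \<open>q\<close>.\<close>
    have "(q * b - b) * p = 0" if p: "p \<in> P" for p
      using hyp[OF p] up'[OF p] by (simp add: algebra_simps) (metis mult.assoc)
    then have "(q * b - b) * q = 0"
      unfolding q_def by (rule mult_proj_Sup_eq_0[OF P])
    then show ?thesis by (simp add: algebra_simps)
  qed
  show ?thesis
    unfolding q_def[symmetric] using comp
    by (cases \<alpha>; hypsubst_thin; unfold compatible.simps; blast intro: left right)
qed

lemma compatible_proj_Inf:
  fixes b :: "'a::baer_star_ring"
  assumes P: "P \<subseteq> projections" and ne: "P \<noteq> {}" and le: "\<And>p. p \<in> P \<Longrightarrow> p * lp b = p"
    and comp: "\<And>p. p \<in> P \<Longrightarrow> compatible \<alpha> b p"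
  shows "compatible \<alpha> b (\<Sqinter>\<^bsub>proj_order\<^esub>P)"
proof -
  define q where "q = \<Sqinter>\<^bsub>proj_order\<^esub>P"
  have q: "q \<in> projections" and low: "\<And>p. p \<in> P \<Longrightarrow> q * p = q"
    using proj_Inf_projection[OF P] proj_Inf_lower[OF P] by (auto simp: q_def)
  have low': "p * q = q" if "p \<in> P" for p
    using low[OF that] projection_absorb_commute[OF q, of p] P that by auto
  \<comment> \<open>Any member of the nonempty set \<open>P\<close> lies between \<open>q\<close>
    and \<open>lp b\<close>.\<close>
  have qb: "lp b * q = q"
    using ne low le projection_absorb_commute[OF q lp_projection, of b] by (metis ex_in_conv mult.assoc)
  have left: "q * b * q = q * b * lp b" if hyp: "\<And>p. p \<in> P \<Longrightarrow> p * b * p = p * b * lp b"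
  proof -
    \<comment> \<open>Since \<open>q = q * p\<close>, the hypothesis turns
      \<open>q * b * lp b\<close> into a product ending in \<open>p\<close>. Being fixed by every
      \<open>p\<close> on the right then passes to the infimum.\<close>
    have "q * b * lp b * p = q * b * lp b" if p: "p \<in> P" for p
    proof -
      have "q * b * lp b = q * (p * b * lp b)" using low[OF p] by (metis mult.assoc)
      also have "\<dots> = q * (p * b * p)" using hyp[OF p] by simp
      finally have "q * b * lp b = q * (p * b * p)" .
      moreover have "p * p = p" using P p projection_idem by blast
      ultimately show ?thesis by (simp add: mult.assoc)
    qed
    then have "q * b * lp b * q = q * b * lp b"
      unfolding q_def by (rule mult_proj_Inf_eq[OF P])
    then show ?thesis using qb by (simp add: mult.assoc)
  qed
  have right: "q * b * q = b * q" if hyp: "\<And>p. p \<in> P \<Longrightarrow> p * b * p = b * p"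
  proof -
    have "p * (b * q) = b * q" if p: "p \<in> P" for p
      using hyp[OF p] low'[OF p] by (metis mult.assoc)
    then have "q * (b * q) = b * q"
      unfolding q_def by (rule proj_Inf_mult_eq[OF P])
    then show ?thesis by (simp add: mult.assoc)
  qed
  show ?thesis
    unfolding q_def[symmetric] using comp
    by (cases \<alpha>; hypsubst_thin; unfold compatible.simps; blast intro: left right)
qed

theorem theorem44:
  fixes \<alpha> :: star_order
    and b :: "'a::regular_baer_star_ring"
    and B :: "'a set"
  assumes "B \<noteq> {}"
    and "\<forall>c\<in>B. order_le \<alpha> c b"
  shows "is_lub (initial_segment \<alpha> b) (\<Squnion>\<^bsub>proj_order\<^esub>(lp ` B) * b) B \<and>
         is_glb (initial_segment \<alpha> b) (\<Sqinter>\<^bsub>proj_order\<^esub>(lp ` B) * b) B"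
proof -
  define s where "s = \<Squnion>\<^bsub>proj_order\<^esub>(lp ` B)"
  define i where "i = \<Sqinter>\<^bsub>proj_order\<^esub>(lp ` B)"
  have P: "lp ` B \<subseteq> projections" and le: "\<And>p. p \<in> lp ` B \<Longrightarrow> p * lp b = p"
    and comp: "\<And>p. p \<in> lp ` B \<Longrightarrow> compatible \<alpha> b p"
    using assms(2) lp_projection by (auto simp: order_le_iff)
  have s: "s \<in> projections" "s * lp b = s" "compatible \<alpha> b s"
    unfolding s_def by (rule proj_Sup_projection[OF P], rule proj_Sup_least[OF P lp_projection le],
        assumption, rule compatible_proj_Sup[OF P le comp])
  obtain p where p: "p \<in> lp ` B" using assms(1) by blast
  have i: "i \<in> projections" "compatible \<alpha> b i"
    unfolding i_def using proj_Inf_projection[OF P] compatible_proj_Inf[OF P _ le comp] assms(1)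
    by auto
  have ib: "i * lp b = i"
    using proj_Inf_lower[OF P p] le[OF p] unfolding i_def by (metis mult.assoc)
  have sb_le: "order_le \<alpha> (s * b) b" and ib_le: "order_le \<alpha> (i * b) b"
    using s i ib by (auto intro: order_le_projection_mult)
  \<comment> \<open>With these left projections known, every comparison with \<open>s * b\<close> or
    \<open>i * b\<close> in the segment becomes a comparison of projections with \<open>s\<close> or
    \<open>i\<close>.\<close>
  have lps: "lp (s * b) = s" and lpi: "lp (i * b) = i"
    using s i ib by (auto intro: lp_projection_mult)
  have "order_le \<alpha> c (s * b)" "order_le \<alpha> (i * b) c" if "c \<in> B" for c
    using order_le_below_iff[OF _ sb_le, of c] order_le_below_iff[OF ib_le, of c] that assms(2)
      proj_Sup_upper[OF P, of "lp c"] proj_Inf_lower[OF P, of "lp c"] lps lpi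
    by (auto simp: s_def i_def)
  moreover have "order_le \<alpha> (s * b) d"
    if "order_le \<alpha> d b" "\<And>c. c \<in> B \<Longrightarrow> order_le \<alpha> c d" for d
  proof -
    \<comment> \<open>Each \<open>lp c\<close> lies below \<open>lp d\<close>, so
      \<open>lp d\<close> is an upper bound of the projections whose supremum is
      \<open>s\<close>.\<close>
    have "s * lp d = s"
      unfolding s_def using that(2)
      by (intro proj_Sup_least[OF P lp_projection]) (auto simp: order_le_iff)
    then show ?thesis using order_le_below_iff[OF sb_le that(1)] lps by simp
  qed
  moreover have "order_le \<alpha> d (i * b)"
    if "order_le \<alpha> d b" "\<And>c. c \<in> B \<Longrightarrow> order_le \<alpha> d c" for d
  proof -
    have "lp d * i = lp d"
      unfolding i_def using that(2)
      by (intro proj_Inf_greatest[OF P lp_projection]) (auto simp: order_le_iff)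
    then show ?thesis using order_le_below_iff[OF that(1) ib_le] lpi by simp
  qed
  ultimately show ?thesis
    unfolding s_def[symmetric] i_def[symmetric] least_def greatest_def Upper_def Lower_def
      initial_segment_def
    using sb_le ib_le assms(2) by auto
qed

end
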